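(* Let $n$ be a positive integer, let $\lambda_1,\dots,\lambda_n>0$ and let $d_1,\dots,d_n$ be nonnegative integers. Let $(f_1,\dots,f_n)$ be a tuple of real-valued functions on $(0,\infty)$ solving, for each $i=1,\dots,n$, $$f_i''+\frac1r f_i'-\frac{d_i^2}{r^2}f_i+\frac{1}{\lambda_i}f_i\Big(n-\sum_{j=1}^n|f_j|^2\Big)=0\quad\text{for } r>0,$$ $$f_i(r)=b_i r^{d_i}+o(r^{d_i})\ \text{ as } r\searrow 0,\quad\text{for some } b_i>0,$$ and suppose that for each $i$, $f_i(r)\nearrow\alpha_i$ as $r\to\infty$ for some $\alpha_i\in(0,n)$, where $\alpha_1^2+\cdots+\alpha_n^2=n$. If $\lambda_1=\cdots=\lambda_n$, then $d_1=\cdots=d_n$.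
   Context: Solutions are classical (twice continuously differentiable on $(0,\infty)$). The notation $f_i(r)\nearrow\alpha_i$ as $r\to\infty$ means that $f_i$ is monotonically increasing in $r$ and converges to $\alpha_i$. *)

theory Defs
  imports "HOL-Analysis.Analysis" "HOL-Library.Landau_Symbols"
begin

text \<open>
  Functions on \<open>(0, \<infinity>)\<close> are represented by total functions on the reals; every condition below
  depends only on their values on \<open>{0<..}\<close> (an open set, so \<open>deriv\<close> there is also unaffected by
  the values elsewhere).
\<close>

definition C2_on_pos :: "(real \<Rightarrow> real) \<Rightarrow> bool" where
  "C2_on_pos f \<longleftrightarrow>
     f differentiable_on {0<..} \<and>
     deriv f differentiable_on {0<..} \<and>
     continuous_on {0<..} (deriv (deriv f))"

text \<open>Components are indexed by \<open>{1..n}\<close>; values of \<open>l\<close>, \<open>d\<close>, \<open>f\<close> at other indices play no role.\<close>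

definition radial_system ::
  "nat \<Rightarrow> (nat \<Rightarrow> real) \<Rightarrow> (nat \<Rightarrow> nat) \<Rightarrow> (nat \<Rightarrow> real \<Rightarrow> real) \<Rightarrow> bool" where
  "radial_system n l d f \<longleftrightarrow>
     (\<forall>i\<in>{1..n}. C2_on_pos (f i) \<and>
       (\<forall>r>0. deriv (deriv (f i)) r + 1 / r * deriv (f i) r - (real (d i))\<^sup>2 / r\<^sup>2 * f i r
          + 1 / l i * f i r * (real n - (\<Sum>j=1..n. \<bar>f j r\<bar>\<^sup>2)) = 0))"

definition increases_to :: "(real \<Rightarrow> real) \<Rightarrow> real \<Rightarrow> bool" where
  "increases_to f a \<longleftrightarrow> mono_on {0<..} f \<and> (f \<longlongrightarrow> a) at_top"

end

theory Submission
  imports Defs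
begin

text \<open>
  When all \<open>l i\<close> coincide, every component solves the same linear equation
  \<open>u'' + u' / r - a / r\<^sup>2 * u + V * u = 0\<close>, where the nonlinearity is hidden in a common potential
  \<open>V\<close> and only the constant \<open>a = (d i)\<^sup>2\<close> depends on the component. For two solutions \<open>u, v\<close> with
  constants \<open>a < b\<close>, the potential cancels in the Wronskian \<open>W = r * (u * v' - u' * v)\<close>, which
  satisfies \<open>r * W' = (b - a) * u * v\<close>. If \<open>u\<close> and \<open>v\<close> have positive limits, then \<open>r * W'\<close> is
  bounded below by a positive constant for large \<open>r\<close>, so \<open>W\<close> grows at least like \<open>ln r\<close>. Now
  \<open>r * (v / u)' = W / u\<^sup>2\<close> is eventually at least \<open>1\<close>, so \<open>v / u\<close> grows at least like \<open>ln r\<close> as well.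
  But \<open>v / u\<close> converges to the quotient of the two limits, a contradiction. Hence two
  components with positive limits cannot have different values of \<open>d\<close>.
\<close>

text \<open>
  Both divergence steps rest on this comparison with \<open>c * ln r\<close>: the hypothesis says that
  \<open>u - c * ln\<close> is eventually nondecreasing.
\<close>

lemma filterlim_at_top_if_log_derivative_ge:
  fixes u u' :: "real \<Rightarrow> real"
  assumes "c > 0"
    and deriv: "eventually (\<lambda>r. (u has_real_derivative u' r) (at r)) at_top"
    and ge: "eventually (\<lambda>r. c \<le> r * u' r) at_top"
  shows "filterlim u at_top at_top"
proof -
  have "eventually (\<lambda>r. (u has_real_derivative u' r) (at r) \<and> c \<le> r * u' r) at_top"
    using deriv ge by (rule eventually_conj)
  then obtain R0 where R0: "\<And>r. r \<ge> R0 \<Longrightarrow> (u has_real_derivative u' r) (at r) \<and> c \<le> r * u' r"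
    unfolding eventually_at_top_linorder by blast
  define R where "R = max R0 1"
  have mono: "u R - c * ln R \<le> u r - c * ln r" if "r \<ge> R" for r
  proof (rule DERIV_nonneg_imp_nondecreasing[OF that])
    fix x assume "R \<le> x" "x \<le> r"
    then have x: "x > 0" "(u has_real_derivative u' x) (at x)" "c \<le> x * u' x"
      using R0[of x] by (auto simp: R_def)
    have "((\<lambda>t. u t - c * ln t) has_real_derivative u' x - c / x) (at x)"
      using x by (auto intro!: derivative_eq_intros)
    moreover have "u' x - c / x \<ge> 0"
      using x by (simp add: field_simps)
    ultimately show "\<exists>y. ((\<lambda>t. u t - c * ln t) has_real_derivative y) (at x) \<and> 0 \<le> y"
      by blast
  qed
  have "filterlim (\<lambda>r. (u R - c * ln R) + c * ln r) at_top at_top"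
    by (intro filterlim_tendsto_add_at_top[OF tendsto_const]
        filterlim_tendsto_pos_mult_at_top[OF tendsto_const] \<open>c > 0\<close> ln_at_top)
  moreover have "eventually (\<lambda>r. (u R - c * ln R) + c * ln r \<le> u r) at_top"
    using eventually_ge_at_top[of R] by eventually_elim (use mono in force)
  ultimately show ?thesis
    by (rule filterlim_at_top_mono)
qed

text \<open>
  In \<open>W'\<close> the terms with \<open>V\<close> cancel, so any common potential is allowed. The larger constant makes
  \<open>v\<close> outgrow \<open>u\<close> logarithmically, which finite positive limits exclude.
\<close>

lemma angular_constants_not_less:
  fixes u v u' v' u'' v'' V :: "real \<Rightarrow> real"
  assumes u: "\<And>r. r > 0 \<Longrightarrow> (u has_real_derivative u' r) (at r)"
      "\<And>r. r > 0 \<Longrightarrow> (u' has_real_derivative u'' r) (at r)"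
    and v: "\<And>r. r > 0 \<Longrightarrow> (v has_real_derivative v' r) (at r)"
      "\<And>r. r > 0 \<Longrightarrow> (v' has_real_derivative v'' r) (at r)"
    and equ: "\<And>r. r > 0 \<Longrightarrow> u'' r + 1 / r * u' r - a / r\<^sup>2 * u r + V r * u r = 0"
    and eqv: "\<And>r. r > 0 \<Longrightarrow> v'' r + 1 / r * v' r - b / r\<^sup>2 * v r + V r * v r = 0"
    and lim: "(u \<longlongrightarrow> \<alpha>) at_top" "(v \<longlongrightarrow> \<beta>) at_top" "\<alpha> > 0" "\<beta> > 0"
  shows "\<not> a < b"
proof
  assume "a < b"
  define W where "W = (\<lambda>r. r * (u r * v' r - u' r * v r))"
  have W_deriv: "(W has_real_derivative (b - a) * u r * v r / r) (at r)" if "r > 0" for r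
  proof -
    have "(W has_real_derivative (u r * v' r - u' r * v r) + r * (u r * v'' r - u'' r * v r)) (at r)"
      unfolding W_def using u[OF that] v[OF that]
      by (auto intro!: derivative_eq_intros simp: algebra_simps)
    moreover have "u'' r = - (1 / r * u' r) + a / r\<^sup>2 * u r - V r * u r"
        "v'' r = - (1 / r * v' r) + b / r\<^sup>2 * v r - V r * v r"
      using equ[OF that] eqv[OF that] by linarith+
    then have "(u r * v' r - u' r * v r) + r * (u r * v'' r - u'' r * v r) = (b - a) * u r * v r / r"
      using that by (simp only:) (simp add: field_simps power2_eq_square)
    ultimately show ?thesis
      by simp
  qed
  have "((\<lambda>r. (b - a) * u r * v r) \<longlongrightarrow> (b - a) * \<alpha> * \<beta>) at_top"
    by (intro tendsto_intros lim)
  \<comment> \<open>The limit is positive, so half of it is an eventual lower bound for \<open>r * W'\<close>.\<close>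
  moreover have c: "(b - a) * \<alpha> * \<beta> > 0"
    using \<open>a < b\<close> lim by simp
  ultimately have "eventually (\<lambda>r. (b - a) * \<alpha> * \<beta> / 2 < (b - a) * u r * v r) at_top"
    by (elim order_tendstoD(1)) linarith
  then have "eventually (\<lambda>r. (b - a) * \<alpha> * \<beta> / 2 \<le> r * ((b - a) * u r * v r / r)) at_top"
    using eventually_gt_at_top[of 0] by eventually_elim simp
  moreover have "eventually (\<lambda>r. (W has_real_derivative (b - a) * u r * v r / r) (at r)) at_top"
    using eventually_gt_at_top[of 0] by eventually_elim (rule W_deriv)
  ultimately have W_lim: "filterlim W at_top at_top"
    using c by (intro filterlim_at_top_if_log_derivative_ge[of "(b - a) * \<alpha> * \<beta> / 2"]) (simp, assumption+)

  have u_pos: "eventually (\<lambda>r. u r > 0) at_top"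
    using lim by (intro order_tendstoD)
  have "filterlim (\<lambda>r. inverse ((u r)\<^sup>2) * W r) at_top at_top"
  proof (rule filterlim_tendsto_pos_mult_at_top[OF _ _ W_lim])
    show "((\<lambda>r. inverse ((u r)\<^sup>2)) \<longlongrightarrow> inverse (\<alpha>\<^sup>2)) at_top"
      using lim by (intro tendsto_intros) auto
  qed (use lim in simp)
  then have "eventually (\<lambda>r. 1 \<le> inverse ((u r)\<^sup>2) * W r) at_top"
    by (simp add: filterlim_at_top)
  then have "eventually (\<lambda>r. 1 \<le> r * (W r / (r * (u r)\<^sup>2))) at_top"
    using eventually_gt_at_top[of 0] by eventually_elim (simp add: field_simps)
  moreover have "eventually (\<lambda>r. ((\<lambda>r. v r / u r) has_real_derivative W r / (r * (u r)\<^sup>2)) (at r)) at_top"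
    using u_pos eventually_gt_at_top[of 0]
  proof eventually_elim
    case (elim r)
    then have "((\<lambda>r. v r / u r) has_real_derivative (v' r * u r - v r * u' r) / (u r * u r)) (at r)"
      using u(1) v(1) by (intro DERIV_divide) auto
    moreover have "(v' r * u r - v r * u' r) / (u r * u r) = W r / (r * (u r)\<^sup>2)"
      using elim by (simp add: W_def field_simps power2_eq_square)
    ultimately show ?case
      by simp
  qed
  ultimately have "filterlim (\<lambda>r. v r / u r) at_top at_top"
    by (intro filterlim_at_top_if_log_derivative_ge[where c = 1]) auto
  then have "filterlim (\<lambda>r. v r / u r) at_infinity at_top"
    by (rule filterlim_at_top_imp_at_infinity)
  moreover have "((\<lambda>r. v r / u r) \<longlongrightarrow> \<beta> / \<alpha>) at_top"
    using lim by (intro tendsto_divide) auto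
  ultimately show False
    using not_tendsto_and_filterlim_at_infinity[OF trivial_limit_at_top_linorder] by blast
qed

lemma C2_on_pos_has_real_derivative:
  assumes "C2_on_pos f" "r > 0"
  shows "(f has_real_derivative deriv f r) (at r)"
    and "(deriv f has_real_derivative deriv (deriv f) r) (at r)"
  using assms
  by (auto simp: C2_on_pos_def differentiable_on_eq_differentiable_at
      DERIV_deriv_iff_real_differentiable)

theorem theorem1p2:
  fixes n :: nat
    and l :: "nat \<Rightarrow> real"
    and d :: "nat \<Rightarrow> nat"
    and f :: "nat \<Rightarrow> real \<Rightarrow> real"
    and \<alpha> :: "nat \<Rightarrow> real"
  assumes "n > 0"
    and "\<forall>i\<in>{1..n}. l i > 0"
    and "radial_system n l d f"
    and "\<forall>i\<in>{1..n}. \<exists>b>0. (\<lambda>r. f i r - b * r ^ d i) \<in> o[at_right 0](\<lambda>r. r ^ d i)"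
    and "\<forall>i\<in>{1..n}. 0 < \<alpha> i \<and> \<alpha> i < real n \<and> increases_to (f i) (\<alpha> i)"
    and "(\<Sum>i=1..n. (\<alpha> i)\<^sup>2) = real n"
    and "\<forall>i\<in>{1..n}. \<forall>j\<in>{1..n}. l i = l j"
  shows "\<forall>i\<in>{1..n}. \<forall>j\<in>{1..n}. d i = d j"
proof -
  define V where "V = (\<lambda>r. 1 / l 1 * (real n - (\<Sum>j=1..n. \<bar>f j r\<bar>\<^sup>2)))"
  have C2: "C2_on_pos (f i)" and lim: "(f i \<longlongrightarrow> \<alpha> i) at_top" "\<alpha> i > 0" if "i \<in> {1..n}" for i
    using assms(3,5) that by (auto simp: radial_system_def increases_to_def)
  have eq: "deriv (deriv (f i)) r + 1 / r * deriv (f i) r - (real (d i))\<^sup>2 / r\<^sup>2 * f i r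
      + V r * f i r = 0" if "i \<in> {1..n}" "r > 0" for i r
  proof -
    have "l i = l 1"
      using assms(1,7) that by (metis One_nat_def Suc_leI atLeastAtMost_iff order_refl)
    then have "V r * f i r = 1 / l i * f i r * (real n - (\<Sum>j=1..n. \<bar>f j r\<bar>\<^sup>2))"
      by (simp add: V_def)
    then show ?thesis
      using assms(3) that unfolding radial_system_def by simp
  qed
  have "\<not> (real (d i))\<^sup>2 < (real (d j))\<^sup>2" if "i \<in> {1..n}" "j \<in> {1..n}" for i j
    by (rule angular_constants_not_less[OF C2_on_pos_has_real_derivative[OF C2]
          C2_on_pos_has_real_derivative[OF C2] eq eq lim(1) lim(1) lim(2) lim(2)])
      (use that in auto)
  then have "d j \<le> d i" if "i \<in> {1..n}" "j \<in> {1..n}" for i j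
    using that by (simp add: not_less power2_le_iff_abs_le)
  then show ?thesis
    by (simp add: order_antisym)
qed

end
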